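(* Let $n$ be a positive integer. If $(a,b,c)$ is an $n$-powerful triple and $t = t_n(a,b,c) = \frac{a^n - b^n}{c^{n+1}}$, then the triple of positive integers $(x,y,z) = (at, bt, ct)$ is a solution of the diophantine equation $x^n - y^n = z^{n+1}$. Moreover, the map $(a,b,c) \mapsto (a\,t_n(a,b,c),\, b\,t_n(a,b,c),\, c\,t_n(a,b,c))$ restricted to relatively prime $n$-powerful triples is a one-to-one correspondence between relatively prime $n$-powerful triples and positive integral solutions $(x,y,z)$ of $x^n - y^n = z^{n+1}$.
   Context: A triple $(a,b,c)$ of positive integers is called $n$-powerful if $a > b$ and $c^{n+1}$ divides $a^n - b^n$; equivalently, $t_n(a,b,c) = \frac{a^n - b^n}{c^{n+1}}$ is a positive integer. A triple $(a,b,c)$ is relatively prime if $\gcd(a,b,c) = 1$. *)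

theory Defs
  imports Main
begin

(* Positive integers are positive elements of int, so that subtraction is not truncated. *)

definition powerful_triple :: "nat \<Rightarrow> int \<times> int \<times> int \<Rightarrow> bool" where
  "powerful_triple n = (\<lambda>(a, b, c).
     a > 0 \<and> b > 0 \<and> c > 0 \<and> a > b \<and> c ^ (n + 1) dvd a ^ n - b ^ n)"

(* On n-powerful triples the division is exact, so div is the true quotient. *)
definition t_val :: "nat \<Rightarrow> int \<times> int \<times> int \<Rightarrow> int" where
  "t_val n = (\<lambda>(a, b, c). (a ^ n - b ^ n) div c ^ (n + 1))"

definition rel_prime_triple :: "int \<times> int \<times> int \<Rightarrow> bool" where
  "rel_prime_triple = (\<lambda>(a, b, c). gcd a (gcd b c) = 1)"

definition pos_solution :: "nat \<Rightarrow> int \<times> int \<times> int \<Rightarrow> bool" where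
  "pos_solution n = (\<lambda>(x, y, z).
     x > 0 \<and> y > 0 \<and> z > 0 \<and> x ^ n - y ^ n = z ^ (n + 1))"

definition scale_map :: "nat \<Rightarrow> int \<times> int \<times> int \<Rightarrow> int \<times> int \<times> int" where
  "scale_map n = (\<lambda>(a, b, c).
     (a * t_val n (a, b, c), b * t_val n (a, b, c), c * t_val n (a, b, c)))"

end

(* The inverse map divides a solution (x, y, z) by g = gcd x (gcd y z): cancelling g^n in
   (g a)^n - (g b)^n = (g c)^(n+1) leaves a^n - b^n = g c^(n+1), so (a, b, c) is n-powerful and
   its t-value is exactly the g that was divided out. *)
theory Submission
  imports Defs
begin

text \<open>Divisibility makes the \<open>div\<close> in \<open>t_val\<close> exact, so the scaling
  argument can work with a product equation instead of a quotient.\<close>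

lemma powerful_triple_t_val:
  assumes "powerful_triple n (a, b, c)" and "n > 0"
  shows "t_val n (a, b, c) * c ^ (n + 1) = a ^ n - b ^ n" and "t_val n (a, b, c) > 0"
proof -
  from assms(1) have c: "c > 0" and b: "b > 0" and ab: "b < a"
    and dvd: "c ^ (n + 1) dvd a ^ n - b ^ n"
    by (auto simp: powerful_triple_def)
  show eq: "t_val n (a, b, c) * c ^ (n + 1) = a ^ n - b ^ n"
    unfolding t_val_def prod.case using dvd by (rule dvd_div_mult_self)
  \<comment> \<open>Here \<open>n > 0\<close> is essential: for \<open>n = 0\<close> the difference
    of powers, and with it the t-value, would be 0.\<close>
  have "b ^ n < a ^ n"
    using ab b assms(2) by (intro power_strict_mono) auto
  then have "0 < t_val n (a, b, c) * c ^ (n + 1)"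
    by (simp only: eq)
  moreover have "0 < c ^ (n + 1)"
    using c by (rule zero_less_power)
  ultimately show "t_val n (a, b, c) > 0"
    by (simp only: zero_less_mult_pos2)
qed

text \<open>Scaling multiplies the left side by \<open>t ^ n\<close>; the difference
  \<open>a ^ n - b ^ n\<close> itself contributes the one further factor \<open>t\<close> that the
  exponent \<open>n + 1\<close> on the right requires.\<close>

lemma pos_solution_scale:
  assumes "powerful_triple n (a, b, c)" and "n > 0"
  defines "t \<equiv> t_val n (a, b, c)"
  shows "pos_solution n (a * t, b * t, c * t)"
proof -
  have t: "t * c ^ (n + 1) = a ^ n - b ^ n" and t0: "t > 0"
    using powerful_triple_t_val[OF assms(1,2)] by (simp_all only: t_def)
  have "(a * t) ^ n - (b * t) ^ n = t ^ n * (a ^ n - b ^ n)"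
    by (simp add: power_mult_distrib algebra_simps)
  also have "\<dots> = (c * t) ^ (n + 1)"
    unfolding t[symmetric] by (simp add: power_mult_distrib algebra_simps)
  finally have "(a * t) ^ n - (b * t) ^ n = (c * t) ^ (n + 1)" .
  then show ?thesis
    using assms(1) t0 by (simp add: pos_solution_def powerful_triple_def)
qed

text \<open>This makes the scaling factor recoverable from the image triple alone, which is the
  source of injectivity.\<close>

lemma gcd_scale_rel_prime:
  assumes "rel_prime_triple (a, b, c)" and "t > 0"
  shows "gcd (a * t) (gcd (b * t) (c * t)) = t"
  using assms by (simp add: rel_prime_triple_def abs_mult flip: gcd_mult_distrib_int
      add: mult.commute[of _ t])

lemma pos_solution_descend:
  assumes sol: "pos_solution n (g * a, g * b, g * c)" and "g > 0" and "n > 0"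
  shows "powerful_triple n (a, b, c)" and "t_val n (a, b, c) = g"
proof -
  have pos: "a > 0" "b > 0" "c > 0"
    and eq: "(g * a) ^ n - (g * b) ^ n = (g * c) ^ (n + 1)"
    using sol \<open>g > 0\<close> by (simp_all add: pos_solution_def zero_less_mult_iff)
  have "g ^ n * (a ^ n - b ^ n) = g ^ n * (g * c ^ (n + 1))"
    using eq by (simp add: power_mult_distrib algebra_simps)
  then have key: "a ^ n - b ^ n = g * c ^ (n + 1)"
    using \<open>g > 0\<close> by simp
  \<comment> \<open>A solution carries no explicit condition \<open>x > y\<close>; the order
    \<open>b < a\<close> is recovered from the positivity of the right-hand side.\<close>
  moreover have "g * c ^ (n + 1) > 0"
    using \<open>g > 0\<close> \<open>c > 0\<close> by simp
  ultimately have "b ^ n < a ^ n"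
    by linarith
  then have "b < a"
    using pos by (auto intro: power_less_imp_less_base)
  then show "powerful_triple n (a, b, c)"
    using pos key by (simp add: powerful_triple_def)
  show "t_val n (a, b, c) = g"
    unfolding t_val_def prod.case key using \<open>c > 0\<close> by simp
qed

theorem theorem1:
  fixes n :: nat
  assumes "n > 0"
  shows "(\<forall>a b c t. powerful_triple n (a, b, c) \<and> t = t_val n (a, b, c)
            \<longrightarrow> pos_solution n (a * t, b * t, c * t))
       \<and> bij_betw (scale_map n)
           {p. powerful_triple n p \<and> rel_prime_triple p}
           {q. pos_solution n q}"
proof (intro conjI allI impI)
  fix a b c t
  assume "powerful_triple n (a, b, c) \<and> t = t_val n (a, b, c)"
  then show "pos_solution n (a * t, b * t, c * t)"
    using pos_solution_scale assms by blast
next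
  let ?P = "{p. powerful_triple n p \<and> rel_prime_triple p}"
  let ?inv = "\<lambda>(x, y, z). let g = gcd x (gcd y z) in (x div g, y div g, z div g :: int)"
  have left_inv: "?inv (scale_map n p) = p" if "p \<in> ?P" for p
  proof (cases p)
    case (fields a b c)
    with that have t: "t_val n (a, b, c) > 0" and rp: "rel_prime_triple (a, b, c)"
      using powerful_triple_t_val(2) assms by auto
    show ?thesis
      using t by (simp add: fields scale_map_def Let_def gcd_scale_rel_prime[OF rp t])
  qed
  have surj: "q \<in> scale_map n ` ?P" if "pos_solution n q" for q
  proof (cases q)
    case (fields x y z)
    define g where "g = gcd x (gcd y z)"
    have "x > 0"
      using that by (simp add: fields pos_solution_def)
    then have g: "g > 0"
      by (simp add: g_def)
    have "g dvd x" "g dvd y" "g dvd z"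
      by (auto simp: g_def intro: dvd_trans[OF gcd_dvd2])
    then obtain a b c where abc: "x = g * a" "y = g * b" "z = g * c"
      by (auto elim!: dvdE)
    have sol: "pos_solution n (g * a, g * b, g * c)"
      using that by (simp add: fields abc)
    \<comment> \<open>Pulling \<open>g\<close> out of its own definition as a gcd, then cancelling
      it, shows that the quotients are relatively prime.\<close>
    have "g * gcd a (gcd b c) = g"
      using g g_def unfolding abc by (simp flip: gcd_mult_distrib_int)
    then have "rel_prime_triple (a, b, c)"
      using g by (simp add: rel_prime_triple_def)
    \<comment> \<open>Since the t-value of \<open>(a, b, c)\<close> is \<open>g\<close>,
      \<open>scale_map\<close> multiplies back exactly the factor that was removed.\<close>
    moreover note pos_solution_descend[OF sol g assms]
    ultimately show ?thesis
      by (intro image_eqI[of _ _ "(a, b, c)"])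
        (simp_all add: fields abc scale_map_def mult.commute)
  qed
  have "scale_map n ` ?P \<subseteq> {q. pos_solution n q}"
    using pos_solution_scale assms by (auto simp: scale_map_def)
  with surj have "scale_map n ` ?P = {q. pos_solution n q}"
    by blast
  moreover have "inj_on (scale_map n) ?P"
    using left_inv by (rule inj_on_inverseI)
  ultimately show "bij_betw (scale_map n) ?P {q. pos_solution n q}"
    by (simp add: bij_betw_def)
qed

end
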